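(* Let $f\in L^2(\Omega)$ and $\varepsilon>0$. Let $\tilde u\in H^2(\Omega)\cap H_0^1(\Omega)$ be the solution of $$\varepsilon^2(\triangle\tilde u,\triangle v)+(\nabla\tilde u,\nabla v)=(f,v)\qquad\forall\, v\in H^2(\Omega)\cap H_0^1(\Omega),$$ and let $(\psi,u)\in H_0^1(\Omega)\times H_0^1(\Omega)$ be the solution of the mixed problem $$\varepsilon^2(\nabla\psi,\nabla\varphi)+(\psi,\varphi)=(f,\varphi)\quad\forall\,\varphi\in H_0^1(\Omega),\qquad (\nabla u,\nabla v)=(\psi,v)\quad\forall\, v\in H_0^1(\Omega).$$ Then $\tilde u$ and $u$ are identical if and only if $u\in H^2(\Omega)$.
   Context: $\Omega\subset\mathbb{R}^d$, $d\in\{2,3\}$, is a bounded polygonal ($d=2$) or polyhedral ($d=3$) domain with Lipschitz boundary. $(\cdot,\cdot)$ denotes the $L^2(\Omega)$ inner product (of scalar or vector functions); $H^m(\Omega)$ and $H_0^1(\Omega)$ are the standard Sobolev spaces. The first problem is the primal weak form of $\varepsilon^2\triangle^2u-\triangle u=f$ in $\Omega$ with $u=\triangle u=0$ on $\partial\Omega$; the second is its mixed weak form with $\psi=-\triangle u$. Both problems are taken to be uniquely solvable. *)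

theory Defs
  imports "HOL-Analysis.Analysis"
begin

section \<open>Polygonal and polyhedral Lipschitz domains\<close>

text \<open>Near every boundary point, after a rotation that takes the direction \<open>e\<close> to a coordinate
  direction, the set is the strict epigraph of a Lipschitz function \<open>\<gamma>\<close> on the hyperplane
  orthogonal to \<open>e\<close>.\<close>

definition lipschitz_boundary :: "'a::euclidean_space set \<Rightarrow> bool" where
  "lipschitz_boundary \<Omega> \<longleftrightarrow>
    (\<forall>x\<in>frontier \<Omega>. \<exists>r>0. \<exists>e \<gamma> L. norm e = 1 \<and> L-lipschitz_on {z. z \<bullet> e = 0} \<gamma> \<and>
       \<Omega> \<inter> ball x r = {y \<in> ball x r. \<gamma> (y - (y \<bullet> e) *\<^sub>R e) < y \<bullet> e})"

text \<open>The boundary consists of finitely many flat pieces of codimension one: line segments in the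
  plane, convex polygons in space.  Non-convex faces are unions of several pieces.  Neither the
  domain nor its complement is assumed convex or simply connected.\<close>

definition polyhedral_boundary :: "'a::euclidean_space set \<Rightarrow> bool" where
  "polyhedral_boundary \<Omega> \<longleftrightarrow>
    (\<exists>\<F>. finite \<F> \<and> (\<forall>F\<in>\<F>. polytope F \<and> aff_dim F = int DIM('a) - 1) \<and> frontier \<Omega> = \<Union>\<F>)"

definition polyhedral_lipschitz_domain :: "'a::euclidean_space set \<Rightarrow> bool" where
  "polyhedral_lipschitz_domain \<Omega> \<longleftrightarrow>
    \<Omega> \<noteq> {} \<and> open \<Omega> \<and> connected \<Omega> \<and> bounded \<Omega> \<and> polyhedral_boundary \<Omega> \<and> lipschitz_boundary \<Omega>"

section \<open>Square-integrable functions\<close>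

text \<open>Elements of function spaces on \<open>\<Omega>\<close> are represented by total functions, whose values
  outside \<open>\<Omega>\<close> are irrelevant.  Equality in these spaces is equality almost everywhere on
  \<open>\<Omega>\<close>.\<close>

definition ae_equal :: "'a::euclidean_space set \<Rightarrow> ('a \<Rightarrow> 'b) \<Rightarrow> ('a \<Rightarrow> 'b) \<Rightarrow> bool" where
  "ae_equal \<Omega> u v \<longleftrightarrow> (AE x in lebesgue_on \<Omega>. u x = v x)"

definition L2 :: "'a::euclidean_space set \<Rightarrow> ('a \<Rightarrow> real) set" where
  "L2 \<Omega> = {u \<in> borel_measurable (lebesgue_on \<Omega>). integrable (lebesgue_on \<Omega>) (\<lambda>x. (u x)\<^sup>2)}"

definition L2_inner ::
    "'a::euclidean_space set \<Rightarrow> ('a \<Rightarrow> 'b::real_inner) \<Rightarrow> ('a \<Rightarrow> 'b) \<Rightarrow> real" where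
  "L2_inner \<Omega> u v = (LINT x|lebesgue_on \<Omega>. u x \<bullet> v x)"

section \<open>Test functions and weak derivatives\<close>

definition partial_deriv :: "'n::finite \<Rightarrow> (real^'n \<Rightarrow> real) \<Rightarrow> real^'n \<Rightarrow> real" where
  "partial_deriv i \<phi> x = frechet_derivative \<phi> (at x) (axis i 1)"

text \<open>A list of coordinate indices plays the role of a multi-index; its length is the order.\<close>

definition iter_partial :: "'n::finite list \<Rightarrow> (real^'n \<Rightarrow> real) \<Rightarrow> real^'n \<Rightarrow> real" where
  "iter_partial \<alpha> \<phi> = foldr partial_deriv \<alpha> \<phi>"

definition smooth :: "(real^'n::finite \<Rightarrow> real) \<Rightarrow> bool" where
  "smooth \<phi> \<longleftrightarrow> (\<forall>\<alpha>. iter_partial \<alpha> \<phi> differentiable_on UNIV)"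

definition test_functions :: "(real^'n::finite) set \<Rightarrow> (real^'n \<Rightarrow> real) set" where
  "test_functions \<Omega> =
    {\<phi>. smooth \<phi> \<and> compact (closure {x. \<phi> x \<noteq> 0}) \<and> closure {x. \<phi> x \<noteq> 0} \<subseteq> \<Omega>}"

definition has_weak_deriv ::
    "(real^'n::finite) set \<Rightarrow> 'n list \<Rightarrow> (real^'n \<Rightarrow> real) \<Rightarrow> (real^'n \<Rightarrow> real) \<Rightarrow> bool" where
  "has_weak_deriv \<Omega> \<alpha> u g \<longleftrightarrow> u \<in> L2 \<Omega> \<and> g \<in> L2 \<Omega> \<and>
    (\<forall>\<phi>\<in>test_functions \<Omega>.
       L2_inner \<Omega> u (iter_partial \<alpha> \<phi>) = (- 1) ^ length \<alpha> * L2_inner \<Omega> g \<phi>)"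

text \<open>Weak derivatives are unique up to null sets; \<open>weak_deriv\<close> picks a representative.\<close>

definition weak_deriv ::
    "(real^'n::finite) set \<Rightarrow> 'n list \<Rightarrow> (real^'n \<Rightarrow> real) \<Rightarrow> real^'n \<Rightarrow> real" where
  "weak_deriv \<Omega> \<alpha> u = (SOME g. has_weak_deriv \<Omega> \<alpha> u g)"

definition grad :: "(real^'n::finite) set \<Rightarrow> (real^'n \<Rightarrow> real) \<Rightarrow> real^'n \<Rightarrow> real^'n" where
  "grad \<Omega> u x = (\<chi> i. weak_deriv \<Omega> [i] u x)"

definition laplacian :: "(real^'n::finite) set \<Rightarrow> (real^'n \<Rightarrow> real) \<Rightarrow> real^'n \<Rightarrow> real" where
  "laplacian \<Omega> u x = (\<Sum>i\<in>UNIV. weak_deriv \<Omega> [i, i] u x)"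

section \<open>Sobolev spaces\<close>

definition sobolev :: "nat \<Rightarrow> (real^'n::finite) set \<Rightarrow> (real^'n \<Rightarrow> real) set" where
  "sobolev m \<Omega> = {u \<in> L2 \<Omega>. \<forall>\<alpha>. length \<alpha> \<le> m \<longrightarrow> (\<exists>g. has_weak_deriv \<Omega> \<alpha> u g)}"

definition H1_norm :: "(real^'n::finite) set \<Rightarrow> (real^'n \<Rightarrow> real) \<Rightarrow> real" where
  "H1_norm \<Omega> u = sqrt (L2_inner \<Omega> u u + L2_inner \<Omega> (grad \<Omega> u) (grad \<Omega> u))"

text \<open>\<open>H\<^sub>0\<^sup>1(\<Omega>)\<close>, the closure of the test functions in \<open>H\<^sup>1(\<Omega>)\<close>.\<close>

definition H10 :: "(real^'n::finite) set \<Rightarrow> (real^'n \<Rightarrow> real) set" where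
  "H10 \<Omega> = {u \<in> sobolev 1 \<Omega>. \<exists>\<phi>. (\<forall>k::nat. \<phi> k \<in> test_functions \<Omega>) \<and>
     (\<lambda>k. H1_norm \<Omega> (\<lambda>x. u x - \<phi> k x)) \<longlonglongrightarrow> 0}"

section \<open>The two weak problems\<close>

definition primal_solution ::
    "(real^'n::finite) set \<Rightarrow> real \<Rightarrow> (real^'n \<Rightarrow> real) \<Rightarrow> (real^'n \<Rightarrow> real) \<Rightarrow> bool" where
  "primal_solution \<Omega> \<epsilon> f u \<longleftrightarrow> u \<in> sobolev 2 \<Omega> \<inter> H10 \<Omega> \<and>
    (\<forall>v \<in> sobolev 2 \<Omega> \<inter> H10 \<Omega>.
       \<epsilon>\<^sup>2 * L2_inner \<Omega> (laplacian \<Omega> u) (laplacian \<Omega> v) + L2_inner \<Omega> (grad \<Omega> u) (grad \<Omega> v)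
         = L2_inner \<Omega> f v)"

definition mixed_solution ::
    "(real^'n::finite) set \<Rightarrow> real \<Rightarrow> (real^'n \<Rightarrow> real) \<Rightarrow>
       (real^'n \<Rightarrow> real) \<Rightarrow> (real^'n \<Rightarrow> real) \<Rightarrow> bool" where
  "mixed_solution \<Omega> \<epsilon> f \<psi> u \<longleftrightarrow> \<psi> \<in> H10 \<Omega> \<and> u \<in> H10 \<Omega> \<and>
    (\<forall>\<phi> \<in> H10 \<Omega>.
       \<epsilon>\<^sup>2 * L2_inner \<Omega> (grad \<Omega> \<psi>) (grad \<Omega> \<phi>) + L2_inner \<Omega> \<psi> \<phi> = L2_inner \<Omega> f \<phi>) \<and>
    (\<forall>v \<in> H10 \<Omega>. L2_inner \<Omega> (grad \<Omega> u) (grad \<Omega> v) = L2_inner \<Omega> \<psi> v)"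

end

theory Submission
  imports Defs
begin

text \<open>If \<open>u\<close> and the primal solution agree almost everywhere, then \<open>u\<close> has the same weak
  derivatives and so lies in \<open>H\<^sup>2(\<Omega>)\<close> (\<open>sobolev_ae_equal\<close>).

  Conversely, let \<open>u \<in> H\<^sup>2(\<Omega>)\<close>.  The second mixed equation says \<open>\<triangle>u = - \<psi>\<close>, now almost everywhere
  (\<open>laplacian_of_weak_solution\<close>).  Because \<open>\<psi>\<close> lies in \<open>H\<^sub>0\<^sup>1(\<Omega>)\<close>, Green's formula holds without
  a boundary term (\<open>green_H10\<close>) and gives \<open>(\<triangle>u, \<triangle>v) = - (\<psi>, \<triangle>v) = (\<nabla>\<psi>, \<nabla>v)\<close> for every
  \<open>v \<in> H\<^sup>2(\<Omega>) \<inter> H\<^sub>0\<^sup>1(\<Omega>)\<close>.  Adding \<open>(\<nabla>u, \<nabla>v) = (\<psi>, v)\<close> turns the first mixed equation into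
  the primal one (\<open>mixed_solution_solves_primal\<close>), and uniqueness of the primal solution finishes
  the proof.

  Two analytic facts carry this.  The fundamental lemma of the calculus of variations
  (\<open>fundamental_lemma_L2\<close>) makes weak derivatives unique and yields \<open>\<triangle>u = - \<psi>\<close>; it rests on smooth
  approximations of the indicator functions of boxes.  Integration by parts for test functions
  (\<open>test_functions_integration_by_parts\<close>) shows that test functions have their classical
  derivatives as weak ones, so that approximation by test functions in \<open>H\<^sub>0\<^sup>1(\<Omega>)\<close> can be
  exploited.\<close>

section \<open>Smooth functions approximating the indicator of a box\<close>

lemma partial_deriv_eq:
  assumes "(f has_derivative D) (at x)"
  shows "partial_deriv i f x = D (axis i 1)"
  unfolding partial_deriv_def using frechet_derivative_at[OF assms] by simp

lemma partial_deriv_add: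
  assumes "f differentiable at x" "g differentiable at x"
  shows "partial_deriv i (\<lambda>x. f x + g x) x = partial_deriv i f x + partial_deriv i g x"
  using partial_deriv_eq[OF has_derivative_add[OF assms[unfolded frechet_derivative_works]]]
  by (simp add: partial_deriv_def)

lemma partial_deriv_mult:
  assumes "f differentiable at x" "g differentiable at x"
  shows "partial_deriv i (\<lambda>x. f x * g x) x = f x * partial_deriv i g x + partial_deriv i f x * g x"
  using partial_deriv_eq[OF has_derivative_mult[OF assms[unfolded frechet_derivative_works]]]
  by (simp add: partial_deriv_def)

text \<open>The case \<open>m = 0\<close> is the classical smooth function that vanishes to infinite order at \<open>0\<close>.
  The factors \<open>t\<^sup>-\<^sup>m\<close> make the span of the family closed under differentiation, so that all higher
  derivatives are handled without formulas for them.\<close>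

definition flat_exp :: "nat \<Rightarrow> real \<Rightarrow> real" where
  "flat_exp m t = (if t \<le> 0 then 0 else inverse t ^ m * exp (- inverse t))"

lemma tendsto_flat_exp_0: "(flat_exp m \<longlongrightarrow> 0) (at 0)"
proof -
  have "((\<lambda>t. inverse t ^ m / exp (inverse t)) \<longlongrightarrow> (0::real)) (at_right 0)"
    by (rule filterlim_compose[OF tendsto_power_div_exp_0 filterlim_inverse_at_top_right])
  then have "(flat_exp m \<longlongrightarrow> 0) (at_right 0)"
    by (rule Lim_transform_eventually)
      (auto simp: eventually_at_right_field flat_exp_def exp_minus field_simps intro!: exI[of _ 1])
  moreover have "(flat_exp m \<longlongrightarrow> 0) (at_left 0)"
    by (rule Lim_transform_eventually[OF tendsto_const])
      (auto simp: eventually_at_left_field flat_exp_def intro!: exI[of _ "-1"])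
  ultimately show ?thesis
    by (simp add: filterlim_split_at)
qed

lemma DERIV_flat_exp:
  "(flat_exp m has_real_derivative (flat_exp (m + 2) t - real m * flat_exp (m + 1) t)) (at t)"
proof (cases t "0::real" rule: linorder_cases)
  case less
  have "(flat_exp m has_real_derivative 0) (at t)"
    by (rule has_field_derivative_transform_within_open[of "\<lambda>_. 0" _ _ "{..<0}"])
      (use less in \<open>auto simp: flat_exp_def\<close>)
  then show ?thesis using less by (simp add: flat_exp_def)
next
  case equal
  \<comment> \<open>The difference quotient of \<open>flat_exp m\<close> at \<open>0\<close> is \<open>flat_exp (m + 1)\<close>.\<close>
  have "(flat_exp m has_real_derivative 0) (at 0)"
    unfolding DERIV_def
    by (rule Lim_transform_eventually[OF tendsto_flat_exp_0[of "Suc m"]])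
      (auto simp: eventually_at_filter flat_exp_def divide_simps intro!: always_eventually)
  then show ?thesis using equal by (simp add: flat_exp_def)
next
  case greater
  have inv: "(inverse has_real_derivative - (inverse t ^ 2)) (at t)"
    using DERIV_inverse[of t] greater by (simp add: power2_eq_square power_Suc)
  have "((\<lambda>t. inverse t ^ m * exp (- inverse t)) has_real_derivative
      (real m * inverse t ^ (m - 1) * - (inverse t ^ 2)) * exp (- inverse t)
        + inverse t ^ m * (exp (- inverse t) * - (- (inverse t ^ 2)))) (at t)"
    using DERIV_mult[OF DERIV_power[OF inv, of m] DERIV_fun_exp[OF DERIV_minus[OF inv]]]
    by (simp add: mult_ac)
  also have "(real m * inverse t ^ (m - 1) * - (inverse t ^ 2)) * exp (- inverse t)
        + inverse t ^ m * (exp (- inverse t) * - (- (inverse t ^ 2)))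
      = flat_exp (m + 2) t - real m * flat_exp (m + 1) t"
    using greater
    by (cases m) (simp_all add: flat_exp_def algebra_simps power_add power2_eq_square)
  finally have "((\<lambda>t. inverse t ^ m * exp (- inverse t)) has_real_derivative
      (flat_exp (m + 2) t - real m * flat_exp (m + 1) t)) (at t)" .
  then show ?thesis
    by (rule has_field_derivative_transform_within_open[of _ _ _ "{0<..}"])
      (use greater in \<open>auto simp: flat_exp_def\<close>)
qed

text \<open>A set of everywhere differentiable functions that is closed under partial derivatives consists of
  smooth functions.  This algebra is such a set, by the sum, product and chain rules, and it is large
  enough to contain bump functions.\<close>

inductive flat_exp_algebra :: "(real^'n::finite \<Rightarrow> real) \<Rightarrow> bool" where
  const: "flat_exp_algebra (\<lambda>_. c)"
| flat: "flat_exp_algebra (\<lambda>x. flat_exp m (s * x $ i + b))"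
| add: "flat_exp_algebra f \<Longrightarrow> flat_exp_algebra g \<Longrightarrow> flat_exp_algebra (\<lambda>x. f x + g x)"
| mult: "flat_exp_algebra f \<Longrightarrow> flat_exp_algebra g \<Longrightarrow> flat_exp_algebra (\<lambda>x. f x * g x)"

lemma flat_exp_algebra_partial_deriv:
  assumes "flat_exp_algebra f"
  shows "(\<forall>x. f differentiable at x) \<and> flat_exp_algebra (partial_deriv j f)"
  using assms
proof induction
  case (const c)
  have "partial_deriv j (\<lambda>_. c) = (\<lambda>_. 0)"
    by (rule ext, rule partial_deriv_eq[THEN trans, OF has_derivative_const]) simp
  then show ?case by (simp add: flat_exp_algebra.const)
next
  case (flat m s i b)
  have D: "((\<lambda>x. flat_exp m (s * x $ i + b)) has_derivative
     (\<lambda>h. (s * h $ i) * (flat_exp (m + 2) (s * x $ i + b) - real m * flat_exp (m + 1) (s * x $ i + b))))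
     (at x)" for x
  proof -
    have "((\<lambda>x. s * x $ i + b) has_derivative (\<lambda>h. s * h $ i)) (at x)"
      by (auto intro!: derivative_eq_intros bounded_linear.has_derivative[OF bounded_linear_vec_nth])
    from has_derivative_compose[OF this DERIV_flat_exp[of m, unfolded has_field_derivative_def]]
    show ?thesis by (simp add: mult.commute)
  qed
  have eq: "partial_deriv j (\<lambda>x. flat_exp m (s * x $ i + b)) = (\<lambda>x. (s * axis j 1 $ i) *
     (flat_exp (m + 2) (s * x $ i + b) + (- real m) * flat_exp (m + 1) (s * x $ i + b)))"
    by (rule ext) (simp add: partial_deriv_eq[OF D])
  have "flat_exp_algebra (partial_deriv j (\<lambda>x. flat_exp m (s * x $ i + b)))"
    unfolding eq by (intro flat_exp_algebra.intros)
  then show ?case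
    using D by (auto simp: differentiable_def)
next
  case (add f g)
  then have "partial_deriv j (\<lambda>x. f x + g x) = (\<lambda>x. partial_deriv j f x + partial_deriv j g x)"
    by (auto intro!: ext partial_deriv_add)
  with add show ?case by (auto intro!: flat_exp_algebra.intros)
next
  case (mult f g)
  then have "partial_deriv j (\<lambda>x. f x * g x)
      = (\<lambda>x. f x * partial_deriv j g x + partial_deriv j f x * g x)"
    by (auto intro!: ext partial_deriv_mult)
  with mult show ?case by (auto intro!: flat_exp_algebra.intros)
qed

lemma flat_exp_algebra_smooth:
  assumes "flat_exp_algebra f"
  shows "smooth f"
proof -
  have "flat_exp_algebra (iter_partial \<alpha> f)" for \<alpha>
    by (induction \<alpha>) (use assms flat_exp_algebra_partial_deriv in \<open>auto simp: iter_partial_def\<close>)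
  then show ?thesis
    using flat_exp_algebra_partial_deriv
    by (auto simp: smooth_def differentiable_on_def intro: differentiable_at_withinI)
qed

lemma flat_exp_algebra_prod:
  "finite A \<Longrightarrow> (\<And>i. i \<in> A \<Longrightarrow> flat_exp_algebra (f i)) \<Longrightarrow> flat_exp_algebra (\<lambda>x. \<Prod>i\<in>A. f i x)"
  by (induction A rule: finite_induct) (auto intro: flat_exp_algebra.intros)

lemma flat_exp_algebra_power: "flat_exp_algebra f \<Longrightarrow> flat_exp_algebra (\<lambda>x. f x ^ k)"
  by (induction k) (auto intro: flat_exp_algebra.intros)

text \<open>Multiplying the flat functions of the distances to the \<open>2n\<close> faces gives a smooth \<open>p\<close> with
  \<open>0 < p \<le> 1\<close> in the open box and \<open>p = 0\<close> outside.  Then \<open>1 - (1 - p)\<^sup>k\<close> has the same support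
  and increases to the indicator function of the box, so no plateau functions have to be built.\<close>

lemma box_indicator_approximation:
  fixes a b :: "real^'n::finite"
  assumes "cbox a b \<subseteq> \<Omega>"
  obtains \<phi> where "\<And>k::nat. \<phi> k \<in> test_functions \<Omega>"
    and "\<And>k x. 0 \<le> \<phi> k x \<and> \<phi> k x \<le> 1"
    and "\<And>k x. x \<notin> box a b \<Longrightarrow> \<phi> k x = 0"
    and "\<And>x. (\<lambda>k. \<phi> k x) \<longlonglongrightarrow> indicator (box a b) x"
proof
  \<comment> \<open>Differences are written as sums with factors \<open>- 1\<close> to match the rules of
    \<open>flat_exp_algebra\<close> literally.\<close>
  define p where "p = (\<lambda>x::real^'n. \<Prod>i\<in>UNIV.
    flat_exp 0 (1 * x $ i + (- a $ i)) * flat_exp 0 ((- 1) * x $ i + b $ i))"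
  define \<phi> where "\<phi> = (\<lambda>(k::nat) x. 1 + (- 1) * (1 + (- 1) * p x) ^ k)"
  have flat: "0 \<le> flat_exp 0 t" "flat_exp 0 t \<le> 1" "0 < flat_exp 0 t \<longleftrightarrow> 0 < t" for t
    by (auto simp: flat_exp_def)
  have p01: "0 \<le> p x" "p x \<le> 1" for x
    unfolding p_def by (auto intro!: prod_nonneg prod_le_1 mult_le_one mult_nonneg_nonneg flat)
  have p_in: "0 < p x" if "x \<in> box a b" for x
    unfolding p_def using that
    by (intro prod_pos) (auto simp: mem_box_cart flat)
  have p_out: "p x = 0" if "x \<notin> box a b" for x
  proof -
    from that obtain i where "\<not> (a $ i < x $ i \<and> x $ i < b $ i)"
      by (auto simp: mem_box_cart)
    then have "flat_exp 0 (1 * x $ i + (- a $ i)) * flat_exp 0 ((- 1) * x $ i + b $ i) = 0"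
      by (auto simp: flat_exp_def)
    then show ?thesis unfolding p_def by (intro prod_zero) auto
  qed
  have alg: "flat_exp_algebra (\<phi> k)" for k
    unfolding \<phi>_def p_def
    by (intro flat_exp_algebra.intros flat_exp_algebra_prod flat_exp_algebra_power) auto
  have "{x. \<phi> k x \<noteq> 0} \<subseteq> cbox a b" for k
    using p_out box_subset_cbox by (force simp: \<phi>_def)
  then have cl: "closure {x. \<phi> k x \<noteq> 0} \<subseteq> cbox a b" for k
    by (simp add: closure_minimal closed_cbox)
  then have "compact (closure {x. \<phi> k x \<noteq> 0})" for k
    by (meson bounded_cbox bounded_subset closed_closure compact_eq_bounded_closed)
  then show "\<phi> k \<in> test_functions \<Omega>" for k
    unfolding test_functions_def using alg[of k, THEN flat_exp_algebra_smooth] cl[of k] assms by blast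
  show "0 \<le> \<phi> k x \<and> \<phi> k x \<le> 1" for k x
    using p01[of x] by (simp add: \<phi>_def power_le_one)
  show "\<phi> k x = 0" if "x \<notin> box a b" for k x
    using p_out[OF that] by (simp add: \<phi>_def)
  show "(\<lambda>k. \<phi> k x) \<longlonglongrightarrow> indicator (box a b) x" for x
  proof (cases "x \<in> box a b")
    case True
    then have "(\<lambda>k. (1 + (- 1) * p x) ^ k) \<longlonglongrightarrow> 0"
      using p01[of x] p_in[of x] by (intro LIMSEQ_realpow_zero) auto
    from tendsto_diff[OF tendsto_const[of 1] this] show ?thesis
      using True by (simp add: \<phi>_def)
  next
    case False
    then show ?thesis by (simp add: \<phi>_def p_out)
  qed
qed

section \<open>Functions whose integrals over boxes vanish\<close>

text \<open>Open boxes are stable under intersection and generate the Borel sets, so by Dynkin's argument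
  the integral over every Borel set vanishes, and then so does the function.  The argument runs for
  a Borel representative \<open>w'\<close>, because Lebesgue sets are not generated by boxes.\<close>

lemma AE_zero_if_box_integrals_zero:
  fixes w :: "'a::euclidean_space \<Rightarrow> real"
  assumes w: "integrable lebesgue w"
    and zero: "\<And>a b. (LINT x|lebesgue. indicator (box a b) x * w x) = 0"
  shows "AE x in lebesgue. w x = 0"
proof -
  obtain w' where w'[measurable]: "w' \<in> borel_measurable lborel"
    and ae: "AE x in lborel. w x = w' x"
    using completion_ex_borel_measurable_real[of w lborel] w by auto
  have ae': "AE x in lebesgue. w x = w' x"
    using ae by (rule AE_completion)
  have wm[measurable]: "w \<in> borel_measurable lebesgue" using w by auto
  have w'm[measurable]: "w' \<in> borel_measurable lebesgue"
    by (rule measurable_completion[OF w'])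
  have "integrable lebesgue w'"
    using w ae' by (subst integrable_cong_AE[of _ _ w]) auto
  then have int: "integrable lborel w'"
    by (simp add: integrable_completion)
  have int_sub: "set_integrable lborel A w'" if "A \<in> sets borel" for A
    unfolding set_integrable_def using int that by (intro integrable_mult_indicator) auto
  have box0: "(LINT x:box a b|lborel. w' x) = 0" for a b
  proof -
    have "(LINT x|lborel. indicator (box a b) x * w' x) = (LINT x|lebesgue. indicator (box a b) x * w' x)"
      by (rule integral_completion[symmetric]) measurable
    also have "\<dots> = (LINT x|lebesgue. indicator (box a b) x * w x)"
      proof (rule integral_cong_AE)
      show "AE x in lebesgue. indicator (box a b) x * w' x = indicator (box a b) x * w x"
        using ae' by eventually_elim simp
    qed (intro borel_measurable_times borel_measurable_indicator w'm wm, simp)+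
    finally show ?thesis by (simp add: zero set_lebesgue_integral_def)
  qed
  \<comment> \<open>Complements in the Dynkin argument need the integral over the whole space, which is
    the limit of the integrals over growing boxes.\<close>
  have cover: "(\<lambda>n. LINT x:box (- (real n *\<^sub>R One)) (real n *\<^sub>R One)|lborel. w' x) \<longlonglongrightarrow> (LINT x|lborel. w' x)"
    unfolding set_lebesgue_integral_def
  proof (rule integral_dominated_convergence[where w="\<lambda>x. norm (w' x)"])
    show "AE x in lborel. (\<lambda>n. indicator (box (- (real n *\<^sub>R One)) (real n *\<^sub>R One)) x *\<^sub>R w' x) \<longlonglongrightarrow> w' x"
    proof (rule AE_I2)
      fix x :: 'a
      obtain N :: nat where N: "norm x < real N" using reals_Archimedean2 by blast
      have "x \<in> box (- (real n *\<^sub>R One)) (real n *\<^sub>R One)" if "n \<ge> N" for n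
        unfolding mem_box
      proof
        fix i :: 'a assume i: "i \<in> Basis"
        have "norm x < real n" using that N by (meson less_le_trans of_nat_mono)
        with Basis_le_norm[OF i, of x] have "\<bar>x \<bullet> i\<bar> < real n" by linarith
        then show "(- (real n *\<^sub>R One)) \<bullet> i < x \<bullet> i \<and> x \<bullet> i < (real n *\<^sub>R One) \<bullet> i"
          using i by auto
      qed
      then show "(\<lambda>n. indicator (box (- (real n *\<^sub>R One)) (real n *\<^sub>R One)) x *\<^sub>R w' x) \<longlonglongrightarrow> w' x"
        by (intro tendsto_eventually) (auto simp: eventually_sequentially intro!: exI[of _ N])
    qed
    show "AE x in lborel. norm (indicator (box (- (real n *\<^sub>R One)) (real n *\<^sub>R One)) x *\<^sub>R w' x) \<le> norm (w' x)" for n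
      by (auto simp: indicator_def)
  qed (use int in auto)
  have total: "(LINT x|lborel. w' x) = 0"
    using cover unfolding box0 by (simp add: LIMSEQ_const_iff)
  have "(LINT x:A|lborel. w' x) = 0" if "A \<in> sets lborel" for A
  proof -
    from that have A: "A \<in> sigma_sets UNIV (range (\<lambda>(a, b). box a b))"
      by (simp add: borel_eq_box)
    have stable: "Int_stable (range (\<lambda>(a, b). box a b :: 'a set))"
      unfolding Int_stable_def by (auto simp: box_Int_box)
    have sub: "range (\<lambda>(a, b). box a b :: 'a set) \<subseteq> Pow UNIV" by simp
    from stable sub A show ?thesis
    proof (induction A rule: sigma_sets_induct_disjoint)
      case (compl A)
      then have A: "A \<in> sets borel" by (simp add: borel_eq_box)
      have "(LINT x:UNIV|lborel. w' x) = (LINT x:A|lborel. w' x) + (LINT x:UNIV - A|lborel. w' x)"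
        using A int_sub by (subst set_integral_Un[symmetric]) auto
      then show ?case using compl total by (simp add: set_lebesgue_integral_def)
    next
      case (union A)
      then have A: "A i \<in> sets borel" for i by (auto simp: borel_eq_box)
      show ?case
        using union A int_sub
        by (subst lebesgue_integral_countable_add) (auto simp: disjoint_family_on_def)
    qed (use box0 in \<open>auto simp: set_lebesgue_integral_def\<close>)
  qed
  then have "AE x in lborel. w' x = 0"
    by (rule sigma_finite_measure.density_zero[OF lborel.sigma_finite_measure_axioms int])
  with ae have "AE x in lborel. w x = 0" by eventually_elim simp
  then show ?thesis by (rule AE_completion)
qed

section \<open>Square-integrable functions and their inner product\<close>

lemma open_in_lebesgue: "open \<Omega> \<Longrightarrow> \<Omega> \<in> sets lebesgue"
  by (simp add: borel_open)

lemma L2_mult_integrable: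
  assumes "f \<in> L2 \<Omega>" "g \<in> L2 \<Omega>"
  shows "integrable (lebesgue_on \<Omega>) (\<lambda>x. f x * g x)"
proof (rule Bochner_Integration.integrable_bound)
  show "integrable (lebesgue_on \<Omega>) (\<lambda>x. (f x)\<^sup>2 + (g x)\<^sup>2)"
    using assms by (auto simp: L2_def)
  show "(\<lambda>x. f x * g x) \<in> borel_measurable (lebesgue_on \<Omega>)"
    using assms by (auto simp: L2_def)
  have "\<bar>a * b\<bar> \<le> a\<^sup>2 + b\<^sup>2" for a b :: real
  proof -
    have "2 * \<bar>a * b\<bar> \<le> a\<^sup>2 + b\<^sup>2"
      using sum_squares_bound[of "\<bar>a\<bar>" "\<bar>b\<bar>"] by (simp add: abs_mult mult.assoc)
    then show ?thesis using abs_ge_zero[of "a * b"] by linarith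
  qed
  then show "AE x in lebesgue_on \<Omega>. norm (f x * g x) \<le> norm ((f x)\<^sup>2 + (g x)\<^sup>2)"
    by auto
qed

lemma L2_add: "f \<in> L2 \<Omega> \<Longrightarrow> g \<in> L2 \<Omega> \<Longrightarrow> (\<lambda>x. f x + g x) \<in> L2 \<Omega>"
  using L2_mult_integrable[of f \<Omega> g]
  by (auto simp: L2_def power2_sum mult.assoc)

lemma L2_cmult: "f \<in> L2 \<Omega> \<Longrightarrow> (\<lambda>x. c * f x) \<in> L2 \<Omega>"
  by (auto simp: L2_def power_mult_distrib)

lemma L2_diff: "f \<in> L2 \<Omega> \<Longrightarrow> g \<in> L2 \<Omega> \<Longrightarrow> (\<lambda>x. f x - g x) \<in> L2 \<Omega>"
  using L2_add[OF _ L2_cmult[of g \<Omega> "-1"], of f] by simp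

lemma L2_sum: "finite A \<Longrightarrow> (\<And>i. i \<in> A \<Longrightarrow> f i \<in> L2 \<Omega>) \<Longrightarrow> (\<lambda>x. \<Sum>i\<in>A. f i x) \<in> L2 \<Omega>"
proof (induction A rule: finite_induct)
  case empty
  then show ?case by (simp add: L2_def)
qed (auto intro: L2_add)

lemma L2_inner_commute: "L2_inner \<Omega> u v = L2_inner \<Omega> v u"
  by (simp add: L2_inner_def inner_commute)

lemma L2_inner_diff_left:
  fixes u v w :: "'a::euclidean_space \<Rightarrow> real"
  assumes "u \<in> L2 \<Omega>" "v \<in> L2 \<Omega>" "w \<in> L2 \<Omega>"
  shows "L2_inner \<Omega> (\<lambda>x. u x - v x) w = L2_inner \<Omega> u w - L2_inner \<Omega> v w"
  using assms by (simp add: L2_inner_def left_diff_distrib L2_mult_integrable)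

lemma L2_inner_sum_left:
  fixes u :: "'i \<Rightarrow> 'a::euclidean_space \<Rightarrow> real"
  assumes "\<And>i. i \<in> A \<Longrightarrow> u i \<in> L2 \<Omega>" "w \<in> L2 \<Omega>"
  shows "L2_inner \<Omega> (\<lambda>x. \<Sum>i\<in>A. u i x) w = (\<Sum>i\<in>A. L2_inner \<Omega> (u i) w)"
  unfolding L2_inner_def inner_real_def sum_distrib_right
  by (rule Bochner_Integration.integral_sum) (auto intro: L2_mult_integrable assms)

lemma L2_inner_uminus_left: "L2_inner \<Omega> (\<lambda>x. - u x) v = - L2_inner \<Omega> u v"
  by (simp add: L2_inner_def)

lemma L2_inner_cong_left:
  fixes u v w :: "'a::euclidean_space \<Rightarrow> real"
  assumes "ae_equal \<Omega> u v" "u \<in> L2 \<Omega>" "v \<in> L2 \<Omega>" "w \<in> L2 \<Omega>"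
  shows "L2_inner \<Omega> u w = L2_inner \<Omega> v w"
  unfolding L2_inner_def
  by (rule integral_cong_AE) (use assms in \<open>auto simp: L2_def ae_equal_def\<close>)

lemma L2_inner_self_nonneg: "0 \<le> L2_inner \<Omega> u u"
  by (simp add: L2_inner_def)

text \<open>The usual discriminant argument for the nonnegative quadratic polynomial
  \<open>t \<mapsto> (u - t v, u - t v)\<close>; since \<open>(v, v) = 0\<close> makes it affine, that case is separate.\<close>

lemma L2_Cauchy_Schwarz:
  fixes u v :: "'a::euclidean_space \<Rightarrow> real"
  assumes u: "u \<in> L2 \<Omega>" and v: "v \<in> L2 \<Omega>"
  shows "\<bar>L2_inner \<Omega> u v\<bar> \<le> sqrt (L2_inner \<Omega> u u) * sqrt (L2_inner \<Omega> v v)"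
proof -
  let ?a = "L2_inner \<Omega> u u" and ?b = "L2_inner \<Omega> u v" and ?c = "L2_inner \<Omega> v v"
  have quad: "0 \<le> ?a - 2 * t * ?b + t\<^sup>2 * ?c" for t
  proof -
    have "(\<lambda>x. (u x - t * v x) * (u x - t * v x))
        = (\<lambda>x. u x * u x - 2 * t * (u x * v x) + t\<^sup>2 * (v x * v x))"
      by (simp add: fun_eq_iff algebra_simps power2_eq_square)
    then have "L2_inner \<Omega> (\<lambda>x. u x - t * v x) (\<lambda>x. u x - t * v x) = ?a - 2 * t * ?b + t\<^sup>2 * ?c"
      using L2_mult_integrable[OF u u] L2_mult_integrable[OF u v] L2_mult_integrable[OF v v]
      by (simp add: L2_inner_def)
    then show ?thesis using L2_inner_self_nonneg by metis
  qed
  have "?b\<^sup>2 \<le> ?a * ?c"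
  proof (cases "?c = 0")
    case True
    have "?b = 0"
    proof (rule ccontr)
      assume "?b \<noteq> 0"
      \<comment> \<open>At this \<open>t\<close> the affine polynomial has the value \<open>- 1\<close>.\<close>
      then show False using quad[of "(?a + 1) / (2 * ?b)"] True by simp
    qed
    then show ?thesis by (simp add: True)
  next
    case False
    then have "0 < ?c" using L2_inner_self_nonneg[of \<Omega> v] by simp
    then show ?thesis using quad[of "?b / ?c"] by (simp add: field_simps power2_eq_square)
  qed
  then have "sqrt (?b\<^sup>2) \<le> sqrt (?a * ?c)" by (rule real_sqrt_le_mono)
  then show ?thesis by (simp add: real_sqrt_mult)
qed

section \<open>Test functions\<close>

lemma test_functions_vanish: "\<phi> \<in> test_functions \<Omega> \<Longrightarrow> x \<notin> closure {x. \<phi> x \<noteq> 0} \<Longrightarrow> \<phi> x = 0"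
  using closure_subset[of "{x. \<phi> x \<noteq> 0}"] by blast

lemma test_functions_vanish_outside: "\<phi> \<in> test_functions \<Omega> \<Longrightarrow> x \<notin> \<Omega> \<Longrightarrow> \<phi> x = 0"
  using closure_subset[of "{x. \<phi> x \<noteq> 0}"] by (auto simp: test_functions_def)

lemma test_functions_differentiable:
  assumes "\<phi> \<in> test_functions \<Omega>"
  shows "\<phi> differentiable at x"
proof -
  have "iter_partial [] \<phi> differentiable_on UNIV"
    using assms unfolding test_functions_def smooth_def by blast
  then show ?thesis by (simp add: iter_partial_def differentiable_on_def)
qed

lemma test_functions_continuous: "\<phi> \<in> test_functions \<Omega> \<Longrightarrow> continuous_on UNIV \<phi>"
  by (simp add: continuous_at_imp_continuous_on differentiable_imp_continuous_within test_functions_differentiable)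

lemma partial_deriv_vanish:
  assumes "closed K" "\<And>x. x \<notin> K \<Longrightarrow> f x = 0" "x \<notin> K"
  shows "partial_deriv i f x = 0"
proof -
  have "(f has_derivative (\<lambda>_. 0)) (at x)"
    by (rule has_derivative_transform_within_open[of "\<lambda>_. 0" _ _ _ "- K"]) (use assms in auto)
  then show ?thesis by (simp add: partial_deriv_eq)
qed

lemma test_functions_partial_deriv:
  assumes "\<phi> \<in> test_functions \<Omega>"
  shows "partial_deriv i \<phi> \<in> test_functions \<Omega>"
proof -
  have "iter_partial \<alpha> (partial_deriv i \<phi>) = iter_partial (\<alpha> @ [i]) \<phi>" for \<alpha>
    by (simp add: iter_partial_def)
  moreover have "{x. partial_deriv i \<phi> x \<noteq> 0} \<subseteq> closure {x. \<phi> x \<noteq> 0}"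
    using partial_deriv_vanish[of "closure {x. \<phi> x \<noteq> 0}" \<phi>, OF closed_closure test_functions_vanish[OF assms]] by blast
  then have "closure {x. partial_deriv i \<phi> x \<noteq> 0} \<subseteq> closure {x. \<phi> x \<noteq> 0}"
    by (simp add: closure_minimal)
  ultimately show ?thesis
    using assms unfolding test_functions_def smooth_def
    by (auto intro: bounded_subset simp: compact_eq_bounded_closed)
qed

lemma test_functions_iter_partial:
  "\<phi> \<in> test_functions \<Omega> \<Longrightarrow> iter_partial \<alpha> \<phi> \<in> test_functions \<Omega>"
  by (induction \<alpha>) (auto simp: iter_partial_def test_functions_partial_deriv)

lemma integrable_continuous_compact_support:
  fixes f :: "'a::euclidean_space \<Rightarrow> real"
  assumes f: "continuous_on UNIV f" and K: "compact K" and 0: "\<And>x. x \<notin> K \<Longrightarrow> f x = 0"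
  shows "integrable lborel f"
proof -
  have "integrable lborel (\<lambda>x. indicator K x *\<^sub>R f x)"
    by (rule borel_integrable_compact[OF K continuous_on_subset[OF f]]) simp
  moreover have "(\<lambda>x. indicator K x *\<^sub>R f x) = f"
    using 0 by (auto simp: indicator_def fun_eq_iff)
  ultimately show ?thesis by simp
qed

lemma lebesgue_on_continuous_support:
  fixes f :: "'a::euclidean_space \<Rightarrow> real"
  assumes \<Omega>: "open \<Omega>" and f: "continuous_on UNIV f" and 0: "\<And>x. x \<notin> \<Omega> \<Longrightarrow> f x = 0"
  shows "(LINT x|lebesgue_on \<Omega>. f x) = (LINT x|lborel. f x)"
    and "integrable (lebesgue_on \<Omega>) f \<longleftrightarrow> integrable lborel f"
proof -
  have eq: "(\<lambda>x. indicator \<Omega> x *\<^sub>R f x) = f"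
    using 0 by (auto simp: indicator_def fun_eq_iff)
  then have eq': "(\<lambda>x. indicator \<Omega> x * f x) = f" by simp
  have m: "f \<in> borel_measurable lborel"
    using f by (simp add: borel_measurable_continuous_onI)
  show "(LINT x|lebesgue_on \<Omega>. f x) = (LINT x|lborel. f x)"
    using open_in_lebesgue[OF \<Omega>] integral_completion[OF m]
    by (simp add: integral_restrict_space eq')
  show "integrable (lebesgue_on \<Omega>) f \<longleftrightarrow> integrable lborel f"
    using open_in_lebesgue[OF \<Omega>] integrable_completion[OF m]
    by (simp add: integrable_restrict_space eq')
qed

lemma test_functions_L2:
  assumes "open \<Omega>" "\<phi> \<in> test_functions \<Omega>"
  shows "\<phi> \<in> L2 \<Omega>"
proof -
  have c: "continuous_on UNIV \<phi>" using assms(2) by (rule test_functions_continuous)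
  then have "\<phi> \<in> borel_measurable borel" by (rule borel_measurable_continuous_onI)
  then have "\<phi> \<in> borel_measurable (lebesgue_on \<Omega>)"
    by (intro measurable_restrict_space1 measurable_completion) simp
  moreover have "integrable (lebesgue_on \<Omega>) (\<lambda>x. (\<phi> x)\<^sup>2)"
  proof -
    have c2: "continuous_on UNIV (\<lambda>x. (\<phi> x)\<^sup>2)"
      using c by (rule continuous_on_power)
    have "compact (closure {x. \<phi> x \<noteq> 0})"
      using assms(2) unfolding test_functions_def by blast
    then have "integrable lborel (\<lambda>x. (\<phi> x)\<^sup>2)"
      by (rule integrable_continuous_compact_support[OF c2])
        (drule test_functions_vanish[OF assms(2)], simp)
    then show ?thesis
      using test_functions_vanish_outside[OF assms(2)]
      by (subst lebesgue_on_continuous_support[OF assms(1) c2]) simp_all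
  qed
  ultimately show ?thesis by (simp add: L2_def)
qed

section \<open>Integration by parts\<close>

text \<open>The integral is translation invariant, so all difference quotients of \<open>F\<close> in direction \<open>i\<close> have
  integral zero.  For steps of length at most \<open>1\<close> they are dominated by a constant on a fixed ball,
  by the mean value theorem and compactness, so the integral of their limit is zero as well.\<close>

lemma integral_partial_deriv_zero:
  fixes F :: "real^'n::finite \<Rightarrow> real"
  assumes diff: "\<And>x. F differentiable at x"
    and cont: "continuous_on UNIV (partial_deriv i F)"
    and K: "compact K" and out: "\<And>x. x \<notin> K \<Longrightarrow> F x = 0"
  shows "(LINT x|lborel. partial_deriv i F x) = 0"
proof -
  let ?e = "axis i 1 :: real^'n"
  define D where "D = (\<lambda>n x. (F (inverse (real (Suc n)) *\<^sub>R ?e + x) - F x) / inverse (real (Suc n)))"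
  have contF: "continuous_on UNIV F"
    using diff by (simp add: continuous_at_imp_continuous_on differentiable_imp_continuous_within)
  have [measurable]: "F \<in> borel_measurable borel" "partial_deriv i F \<in> borel_measurable borel"
    using contF cont by (simp_all add: borel_measurable_continuous_onI)
  have intF: "integrable lborel F"
    by (rule integrable_continuous_compact_support[OF contF K out])
  have shift: "integrable lborel (\<lambda>x. F (c + x))" "(LINT x|lborel. F (c + x)) = (LINT x|lborel. F x)" for c
  proof -
    have "integrable (distr lborel borel ((+) c)) F" using intF by (simp add: lborel_distr_plus)
    then show "integrable lborel (\<lambda>x. F (c + x))" by (subst (asm) integrable_distr_eq) auto
    have "(LINT x|distr lborel borel ((+) c). F x) = (LINT x|lborel. F (c + x))"
      by (rule integral_distr) auto
    then show "(LINT x|lborel. F (c + x)) = (LINT x|lborel. F x)" by (simp add: lborel_distr_plus)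
  qed
  have D0: "(LINT x|lborel. D n x) = 0" for n
    unfolding D_def using shift intF by simp
  have deriv: "((\<lambda>t. F (t *\<^sub>R ?e + x)) has_real_derivative partial_deriv i F (t *\<^sub>R ?e + x)) (at t)" for x t
  proof -
    have "((\<lambda>t. t *\<^sub>R ?e + x) has_derivative (\<lambda>h. h *\<^sub>R ?e)) (at t)"
      by (auto intro!: derivative_eq_intros)
    from has_derivative_compose[OF this diff[unfolded frechet_derivative_works]]
    have D: "((\<lambda>t. F (t *\<^sub>R ?e + x)) has_derivative
        (\<lambda>h. frechet_derivative F (at (t *\<^sub>R ?e + x)) (h *\<^sub>R ?e))) (at t)" .
    have "linear (frechet_derivative F (at y))" for y
      using diff linear_frechet_derivative by blast
    then have "(\<lambda>h. frechet_derivative F (at (t *\<^sub>R ?e + x)) (h *\<^sub>R ?e))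
        = (*) (partial_deriv i F (t *\<^sub>R ?e + x))"
      by (simp add: fun_eq_iff linear_scale partial_deriv_def)
    with D show ?thesis by (simp add: has_field_derivative_def)
  qed
  have gout: "partial_deriv i F x = 0" if "x \<notin> K" for x
    by (rule partial_deriv_vanish[OF compact_imp_closed[OF K] out that])
  have "bounded (partial_deriv i F ` K)"
    by (intro compact_imp_bounded compact_continuous_image continuous_on_subset[OF cont] K) simp
  then obtain B where B: "B > 0" "\<And>x. x \<in> K \<Longrightarrow> \<bar>partial_deriv i F x\<bar> \<le> B"
    by (auto simp: bounded_pos)
  have B': "\<bar>partial_deriv i F x\<bar> \<le> B" for x
    using B gout[of x] by (cases "x \<in> K") auto
  obtain R where R: "\<And>x. x \<in> K \<Longrightarrow> norm x \<le> R"
    using compact_imp_bounded[OF K] by (auto simp: bounded_iff)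
  have Dbound: "\<bar>D n x\<bar> \<le> B" for n x
  proof -
    let ?h = "inverse (real (Suc n))"
    have "\<exists>z>0. z < ?h \<and> F (?h *\<^sub>R ?e + x) - F (0 *\<^sub>R ?e + x) = (?h - 0) * partial_deriv i F (z *\<^sub>R ?e + x)"
      by (rule MVT2[OF _ deriv]) simp
    then obtain z where "F (?h *\<^sub>R ?e + x) - F x = ?h * partial_deriv i F (z *\<^sub>R ?e + x)" by auto
    then have "D n x = partial_deriv i F (z *\<^sub>R ?e + x)" unfolding D_def by simp
    then show ?thesis using B' by simp
  qed
  have Dout: "D n x = 0" if "x \<notin> cball 0 (R + 1)" for n x
  proof -
    let ?h = "inverse (real (Suc n))"
    have "norm (?h *\<^sub>R ?e) \<le> 1" by (simp add: field_simps)
    then have "norm (?h *\<^sub>R ?e + x) > R"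
      using that norm_triangle_ineq4[of "?h *\<^sub>R ?e + x" "?h *\<^sub>R ?e"] by simp
    moreover have "norm x > R" using that by simp
    ultimately have "x \<notin> K" "?h *\<^sub>R ?e + x \<notin> K" using R by force+
    then show ?thesis by (simp add: D_def out)
  qed
  have "(\<lambda>n. LINT x|lborel. D n x) \<longlonglongrightarrow> (LINT x|lborel. partial_deriv i F x)"
  proof (rule integral_dominated_convergence)
    show "integrable lborel (\<lambda>x. indicator (cball 0 (R + 1)) x *\<^sub>R B)"
      by (rule borel_integrable_compact) auto
    show "AE x in lborel. norm (D n x) \<le> indicator (cball 0 (R + 1)) x *\<^sub>R B" for n
      using Dbound Dout by (auto simp: indicator_def)
    show "AE x in lborel. (\<lambda>n. D n x) \<longlonglongrightarrow> partial_deriv i F x"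
    proof (rule AE_I2)
      fix x
      have "((\<lambda>h. (F ((0 + h) *\<^sub>R ?e + x) - F (0 *\<^sub>R ?e + x)) / h) \<longlongrightarrow> partial_deriv i F (0 *\<^sub>R ?e + x)) (at 0)"
        using deriv[of x 0] unfolding DERIV_def .
      then have "((\<lambda>h. (F (h *\<^sub>R ?e + x) - F x) / h) \<longlongrightarrow> partial_deriv i F x) (at 0)" by simp
      moreover have "filterlim (\<lambda>n. inverse (real (Suc n))) (at 0) sequentially"
        using LIMSEQ_inverse_real_of_nat by (auto simp: filterlim_at)
      ultimately show "(\<lambda>n. D n x) \<longlonglongrightarrow> partial_deriv i F x"
        unfolding D_def by (rule filterlim_compose)
    qed
  qed (auto simp: D_def)
  then show ?thesis by (simp add: D0 LIMSEQ_const_iff)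
qed

text \<open>The product rule and the vanishing integral of the derivative of \<open>\<phi> \<eta>\<close>.  There
  is no boundary term because the support is a compact subset of \<open>\<Omega>\<close>.\<close>

lemma test_functions_integration_by_parts:
  assumes \<Omega>: "open \<Omega>" and \<phi>: "\<phi> \<in> test_functions \<Omega>" and \<eta>: "\<eta> \<in> test_functions \<Omega>"
  shows "L2_inner \<Omega> \<phi> (partial_deriv i \<eta>) = - L2_inner \<Omega> (partial_deriv i \<phi>) \<eta>"
proof -
  let ?F = "\<lambda>x. \<phi> x * \<eta> x"
  note d = test_functions_differentiable[OF \<phi>] test_functions_differentiable[OF \<eta>]
  have D: "partial_deriv i ?F = (\<lambda>x. \<phi> x * partial_deriv i \<eta> x + partial_deriv i \<phi> x * \<eta> x)"
    using d by (auto intro!: ext partial_deriv_mult)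
  have c: "continuous_on UNIV (partial_deriv i ?F)"
    unfolding D by (intro continuous_intros test_functions_continuous[of _ \<Omega>]
      test_functions_partial_deriv \<phi> \<eta>)
  have "(LINT x|lborel. partial_deriv i ?F x) = 0"
  proof (rule integral_partial_deriv_zero[OF _ c])
    show "?F differentiable at x" for x
      using d by (rule differentiable_mult)
    show "compact (closure {x. \<phi> x \<noteq> 0})"
      using \<phi> unfolding test_functions_def by blast
    show "?F x = 0" if "x \<notin> closure {x. \<phi> x \<noteq> 0}" for x
      using test_functions_vanish[OF \<phi> that] by simp
  qed
  moreover have "(LINT x|lebesgue_on \<Omega>. partial_deriv i ?F x) = (LINT x|lborel. partial_deriv i ?F x)"
    by (rule lebesgue_on_continuous_support[OF \<Omega> c])
      (simp add: D test_functions_vanish_outside[OF \<phi>] test_functions_vanish_outside[OF \<eta>])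
  ultimately have "(LINT x|lebesgue_on \<Omega>. \<phi> x * partial_deriv i \<eta> x + partial_deriv i \<phi> x * \<eta> x) = 0"
    by (simp add: D)
  moreover have "integrable (lebesgue_on \<Omega>) (\<lambda>x. \<phi> x * partial_deriv i \<eta> x)"
      "integrable (lebesgue_on \<Omega>) (\<lambda>x. partial_deriv i \<phi> x * \<eta> x)"
    by (intro L2_mult_integrable test_functions_L2 test_functions_partial_deriv \<Omega> \<phi> \<eta>)+
  ultimately show ?thesis by (simp add: L2_inner_def)
qed

section \<open>The fundamental lemma of the calculus of variations\<close>

lemma L2_integrable_on_bounded:
  assumes \<Omega>: "open \<Omega>" and w: "w \<in> L2 \<Omega>"
    and A: "A \<in> sets borel" "bounded A" "A \<subseteq> \<Omega>"
  shows "integrable lebesgue (\<lambda>x. indicator A x * w x)"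
proof -
  have "(indicator A :: 'a \<Rightarrow> real) \<in> L2 \<Omega>"
  proof -
    have Al: "A \<in> sets lebesgue" using A by simp
    have "integrable lebesgue (indicator A :: 'a \<Rightarrow> real)"
      using bounded_set_imp_lmeasurable[OF A(2) Al]
      by (auto simp: integrable_indicator_iff fmeasurable_def top.not_eq_extremum)
    moreover have "indicator \<Omega> x * (indicator A x)\<^sup>2 = (indicator A x :: real)" for x
      using A(3) by (auto simp: indicator_def)
    ultimately have "integrable (lebesgue_on \<Omega>) (\<lambda>x. (indicator A x :: real)\<^sup>2)"
      using open_in_lebesgue[OF \<Omega>] by (simp add: integrable_restrict_space)
    moreover have "(indicator A :: 'a \<Rightarrow> real) \<in> borel_measurable (lebesgue_on \<Omega>)"
      using Al by (intro measurable_restrict_space1 borel_measurable_indicator)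
    ultimately show ?thesis by (simp add: L2_def)
  qed
  from L2_mult_integrable[OF this w]
  have "integrable lebesgue (\<lambda>x. indicator \<Omega> x * (indicator A x * w x))"
    using open_in_lebesgue[OF \<Omega>] by (simp add: integrable_restrict_space)
  moreover have "indicator \<Omega> x * (indicator A x * w x) = indicator A x * w x" for x
    using A(3) by (auto simp: indicator_def)
  ultimately show ?thesis by simp
qed

text \<open>Smooth approximations of the indicator function of the box are admissible test functions;
  dominated convergence passes to the limit.\<close>

lemma L2_box_integral_zero:
  fixes \<Omega> :: "(real^'n::finite) set"
  assumes \<Omega>: "open \<Omega>" and w: "w \<in> L2 \<Omega>"
    and zero: "\<And>\<phi>. \<phi> \<in> test_functions \<Omega> \<Longrightarrow> L2_inner \<Omega> w \<phi> = 0"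
    and box: "cbox a b \<subseteq> \<Omega>"
  shows "(LINT x|lebesgue. indicator (box a b) x * w x) = 0"
proof -
  obtain \<phi> where \<phi>: "\<And>k::nat. \<phi> k \<in> test_functions \<Omega>"
    and \<phi>1: "\<And>k x. 0 \<le> \<phi> k x \<and> \<phi> k x \<le> 1"
    and out: "\<And>k x. x \<notin> box a b \<Longrightarrow> \<phi> k x = 0"
    and lim: "\<And>x. (\<lambda>k. \<phi> k x) \<longlonglongrightarrow> indicator (box a b) x"
    by (rule box_indicator_approximation[OF box]) (rule that)
  have wC: "integrable lebesgue (\<lambda>x. indicator (cbox a b) x * w x)"
    by (rule L2_integrable_on_bounded[OF \<Omega> w _ bounded_cbox box]) simp
  have wB: "integrable lebesgue (\<lambda>x. indicator (box a b) x * w x)"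
    by (rule L2_integrable_on_bounded[OF \<Omega> w _ bounded_box])
      (use box box_subset_cbox[of a b] in \<open>simp_all add: borel_open open_box\<close>)
  have \<phi>m: "\<phi> k \<in> borel_measurable lebesgue" for k
    using test_functions_continuous[OF \<phi>, THEN borel_measurable_continuous_onI]
    by (intro measurable_completion) simp
  have eq: "\<phi> k x * (indicator (cbox a b) x * w x) = indicator \<Omega> x * (w x * \<phi> k x)" for k x
    using out[of x k] box box_subset_cbox[of a b] by (auto simp: indicator_def)
  have "(\<lambda>k. LINT x|lebesgue. \<phi> k x * (indicator (cbox a b) x * w x))
      \<longlonglongrightarrow> (LINT x|lebesgue. indicator (box a b) x * w x)"
  proof (rule integral_dominated_convergence[where w = "\<lambda>x. \<bar>indicator (cbox a b) x * w x\<bar>"])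
    show "AE x in lebesgue. (\<lambda>k. \<phi> k x * (indicator (cbox a b) x * w x)) \<longlonglongrightarrow> indicator (box a b) x * w x"
    proof (rule AE_I2)
      fix x
      have "indicator (box a b) x * (indicator (cbox a b) x * w x) = indicator (box a b) x * w x"
        using box_subset_cbox[of a b] by (auto simp: indicator_def)
      with tendsto_mult_right[OF lim[of x], of "indicator (cbox a b) x * w x"]
      show "(\<lambda>k. \<phi> k x * (indicator (cbox a b) x * w x)) \<longlonglongrightarrow> indicator (box a b) x * w x"
        by simp
    qed
    show "AE x in lebesgue. norm (\<phi> k x * (indicator (cbox a b) x * w x)) \<le> \<bar>indicator (cbox a b) x * w x\<bar>" for k
      using \<phi>1 by (auto simp: abs_mult mult_le_cancel_right1 intro!: mult_left_le_one_le)
  qed (use wC wB \<phi>m in \<open>auto intro!: borel_measurable_times\<close>)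
  moreover have "(LINT x|lebesgue. \<phi> k x * (indicator (cbox a b) x * w x)) = 0" for k
    using zero[OF \<phi>, of k] open_in_lebesgue[OF \<Omega>]
    unfolding eq by (simp add: L2_inner_def integral_restrict_space)
  ultimately show ?thesis by (simp add: LIMSEQ_const_iff)
qed

text \<open>Inside each box whose closure lies in \<open>\<Omega>\<close> all integrals over smaller boxes vanish, hence so does
  \<open>w\<close>; by the Lindelof property countably many such boxes cover \<open>\<Omega>\<close>.\<close>

lemma fundamental_lemma_L2:
  fixes \<Omega> :: "(real^'n::finite) set"
  assumes \<Omega>: "open \<Omega>" and w: "w \<in> L2 \<Omega>"
    and zero: "\<And>\<phi>. \<phi> \<in> test_functions \<Omega> \<Longrightarrow> L2_inner \<Omega> w \<phi> = 0"
  shows "ae_equal \<Omega> w (\<lambda>_. 0)"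
proof -
  have local: "AE x in lebesgue. x \<in> box a b \<longrightarrow> w x = 0" if ab: "cbox a b \<subseteq> \<Omega>" for a b
  proof -
    have "AE x in lebesgue. indicator (box a b) x * w x = 0"
    proof (rule AE_zero_if_box_integrals_zero)
      show "integrable lebesgue (\<lambda>x. indicator (box a b) x * w x)"
        by (rule L2_integrable_on_bounded[OF \<Omega> w _ bounded_box])
          (use ab box_subset_cbox[of a b] in \<open>simp_all add: borel_open open_box\<close>)
    next
      fix c d :: "real^'n"
      obtain p q where pq: "box c d \<inter> box a b = box p q"
        by (metis (no_types) box_Int_box)
      have eq: "indicator (box c d) x * (indicator (box a b) x * w x) = indicator (box p q) x * w x" for x
        unfolding pq[symmetric] by (auto simp: indicator_def)
      show "(LINT x|lebesgue. indicator (box c d) x * (indicator (box a b) x * w x)) = 0"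
      proof (cases "box p q = {}")
        case True
        then show ?thesis unfolding eq by simp
      next
        case False
        then have "cbox p q = closure (box p q)" by (simp add: closure_box)
        also have "\<dots> \<subseteq> cbox a b"
          using pq box_subset_cbox[of a b] by (intro closure_minimal) auto
        finally show ?thesis
          unfolding eq using ab by (intro L2_box_integral_zero[OF \<Omega> w zero]) auto
      qed
    qed
    then show ?thesis by eventually_elim auto
  qed
  define \<B> where "\<B> = {box a b | a b. cbox a b \<subseteq> \<Omega>}"
  have "\<Union>\<B> = \<Omega>"
  proof
    show "\<Union>\<B> \<subseteq> \<Omega>" using box_subset_cbox by (force simp: \<B>_def)
    show "\<Omega> \<subseteq> \<Union>\<B>"
    proof
      fix x assume "x \<in> \<Omega>"
      with \<Omega> obtain a b where "x \<in> box a b" "cbox a b \<subseteq> \<Omega>"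
        by (metis open_contains_cbox)
      then show "x \<in> \<Union>\<B>" by (auto simp: \<B>_def)
    qed
  qed
  moreover obtain \<C> where \<C>: "\<C> \<subseteq> \<B>" "countable \<C>" "\<Union>\<C> = \<Union>\<B>"
    using Lindelof[of \<B>] by (auto simp: \<B>_def)
  moreover have "AE x in lebesgue. \<forall>C\<in>\<C>. x \<in> C \<longrightarrow> w x = 0"
    using \<C>(1,2) local by (subst AE_ball_countable) (auto simp: \<B>_def)
  then have "AE x in lebesgue. x \<in> \<Union>\<C> \<longrightarrow> w x = 0"
    by eventually_elim auto
  ultimately show ?thesis
    using open_in_lebesgue[OF \<Omega>] by (simp add: ae_equal_def AE_restrict_space_iff)
qed

lemma L2_equal_if_tested_equal:
  fixes \<Omega> :: "(real^'n::finite) set"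
  assumes \<Omega>: "open \<Omega>" and v: "v \<in> L2 \<Omega>" and w: "w \<in> L2 \<Omega>"
    and eq: "\<And>\<phi>. \<phi> \<in> test_functions \<Omega> \<Longrightarrow> L2_inner \<Omega> v \<phi> = L2_inner \<Omega> w \<phi>"
  shows "ae_equal \<Omega> v w"
proof -
  have "ae_equal \<Omega> (\<lambda>x. v x - w x) (\<lambda>_. 0)"
    by (rule fundamental_lemma_L2[OF \<Omega> L2_diff[OF v w]])
      (simp add: L2_inner_diff_left v w test_functions_L2 \<Omega> eq)
  then show ?thesis by (simp add: ae_equal_def)
qed

section \<open>Weak derivatives and Sobolev spaces\<close>

lemma has_weak_deriv_L2: "has_weak_deriv \<Omega> \<alpha> u g \<Longrightarrow> u \<in> L2 \<Omega>" "has_weak_deriv \<Omega> \<alpha> u g \<Longrightarrow> g \<in> L2 \<Omega>"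
  by (simp_all add: has_weak_deriv_def)

lemma has_weak_deriv_tested:
  "has_weak_deriv \<Omega> \<alpha> u g \<Longrightarrow> \<phi> \<in> test_functions \<Omega> \<Longrightarrow>
    L2_inner \<Omega> u (iter_partial \<alpha> \<phi>) = (- 1) ^ length \<alpha> * L2_inner \<Omega> g \<phi>"
  by (simp add: has_weak_deriv_def)

text \<open>This frees all later arguments from the choice of representative made by \<open>weak_deriv\<close>.\<close>

lemma has_weak_deriv_unique:
  assumes "open \<Omega>" "has_weak_deriv \<Omega> \<alpha> u g" "has_weak_deriv \<Omega> \<alpha> u h"
  shows "ae_equal \<Omega> g h"
proof (rule L2_equal_if_tested_equal)
  fix \<phi> assume "\<phi> \<in> test_functions \<Omega>"
  from has_weak_deriv_tested[OF assms(2) this] has_weak_deriv_tested[OF assms(3) this]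
  show "L2_inner \<Omega> g \<phi> = L2_inner \<Omega> h \<phi>" by simp
qed (use assms has_weak_deriv_L2 in blast)+

lemma has_weak_deriv_diff:
  assumes \<Omega>: "open \<Omega>" and u: "has_weak_deriv \<Omega> \<alpha> u g" and v: "has_weak_deriv \<Omega> \<alpha> v h"
  shows "has_weak_deriv \<Omega> \<alpha> (\<lambda>x. u x - v x) (\<lambda>x. g x - h x)"
  unfolding has_weak_deriv_def
proof (intro conjI ballI L2_diff)
  fix \<phi> assume \<phi>: "\<phi> \<in> test_functions \<Omega>"
  note L2 = has_weak_deriv_L2[OF u] has_weak_deriv_L2[OF v]
    test_functions_L2[OF \<Omega> \<phi>] test_functions_L2[OF \<Omega> test_functions_iter_partial[OF \<phi>, of \<alpha>]]
  show "L2_inner \<Omega> (\<lambda>x. u x - v x) (iter_partial \<alpha> \<phi>)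
      = (- 1) ^ length \<alpha> * L2_inner \<Omega> (\<lambda>x. g x - h x) \<phi>"
    using L2 has_weak_deriv_tested[OF u \<phi>] has_weak_deriv_tested[OF v \<phi>]
    by (simp add: L2_inner_diff_left right_diff_distrib)
qed (use has_weak_deriv_L2[OF u] has_weak_deriv_L2[OF v] in simp_all)

lemma has_weak_deriv_test_function:
  assumes "open \<Omega>" "\<phi> \<in> test_functions \<Omega>"
  shows "has_weak_deriv \<Omega> [i] \<phi> (partial_deriv i \<phi>)"
  using assms
  by (simp add: has_weak_deriv_def test_functions_L2 test_functions_partial_deriv iter_partial_def
      test_functions_integration_by_parts)

lemma has_weak_deriv_Nil: "u \<in> L2 \<Omega> \<Longrightarrow> has_weak_deriv \<Omega> [] u u"
  by (simp add: has_weak_deriv_def iter_partial_def)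

lemma sobolev_1I:
  assumes "u \<in> L2 \<Omega>" "\<And>i. has_weak_deriv \<Omega> [i] u (g i)"
  shows "u \<in> sobolev 1 \<Omega>"
proof -
  have "\<exists>h. has_weak_deriv \<Omega> \<alpha> u h" if "length \<alpha> \<le> 1" for \<alpha>
  proof (cases \<alpha>)
    case Nil
    then show ?thesis using has_weak_deriv_Nil[OF assms(1)] by blast
  next
    case (Cons i \<beta>)
    then show ?thesis using that assms(2) by auto
  qed
  then show ?thesis using assms(1) by (simp add: sobolev_def)
qed

lemma has_weak_deriv_weak_deriv:
  assumes "u \<in> sobolev m \<Omega>" "length \<alpha> \<le> m"
  shows "has_weak_deriv \<Omega> \<alpha> u (weak_deriv \<Omega> \<alpha> u)"
proof -
  have "\<exists>g. has_weak_deriv \<Omega> \<alpha> u g" using assms by (simp add: sobolev_def)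
  then show ?thesis unfolding weak_deriv_def by (rule someI_ex)
qed

lemmas weak_deriv_L2 = has_weak_deriv_L2(2)[OF has_weak_deriv_weak_deriv]

lemma sobolev_L2: "u \<in> sobolev m \<Omega> \<Longrightarrow> u \<in> L2 \<Omega>"
  by (simp add: sobolev_def)

lemma sobolev_mono: "m \<le> k \<Longrightarrow> sobolev k \<Omega> \<subseteq> sobolev m \<Omega>"
  by (auto simp: sobolev_def)

lemma sobolev_ae_equal:
  assumes \<Omega>: "open \<Omega>" and ae: "ae_equal \<Omega> v u" and v: "v \<in> sobolev m \<Omega>" and u: "u \<in> L2 \<Omega>"
  shows "u \<in> sobolev m \<Omega>"
proof -
  have "has_weak_deriv \<Omega> \<alpha> u g" if g: "has_weak_deriv \<Omega> \<alpha> v g" for \<alpha> g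
    unfolding has_weak_deriv_def
  proof (intro conjI ballI)
    fix \<phi> assume \<phi>: "\<phi> \<in> test_functions \<Omega>"
    have "L2_inner \<Omega> v (iter_partial \<alpha> \<phi>) = L2_inner \<Omega> u (iter_partial \<alpha> \<phi>)"
      by (intro L2_inner_cong_left[OF ae] sobolev_L2[OF v] u test_functions_L2[OF \<Omega>]
        test_functions_iter_partial \<phi>)
    then show "L2_inner \<Omega> u (iter_partial \<alpha> \<phi>) = (- 1) ^ length \<alpha> * L2_inner \<Omega> g \<phi>"
      using has_weak_deriv_tested[OF g \<phi>] by simp
  qed (use u has_weak_deriv_L2[OF g] in auto)
  then show ?thesis using v u unfolding sobolev_def by blast
qed

lemma L2_inner_grad:
  assumes u: "u \<in> sobolev 1 \<Omega>" and v: "v \<in> sobolev 1 \<Omega>"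
  shows "L2_inner \<Omega> (grad \<Omega> u) (grad \<Omega> v)
    = (\<Sum>i\<in>UNIV. L2_inner \<Omega> (weak_deriv \<Omega> [i] u) (weak_deriv \<Omega> [i] v))"
  unfolding L2_inner_def inner_vec_def grad_def
  using weak_deriv_L2[OF u] weak_deriv_L2[OF v]
  by (simp add: Bochner_Integration.integral_sum L2_mult_integrable)

lemma H1_norm_bounds:
  assumes u: "u \<in> sobolev 1 \<Omega>"
  shows "sqrt (L2_inner \<Omega> u u) \<le> H1_norm \<Omega> u"
    and "sqrt (L2_inner \<Omega> (weak_deriv \<Omega> [i] u) (weak_deriv \<Omega> [i] u)) \<le> H1_norm \<Omega> u"
proof -
  have "L2_inner \<Omega> (weak_deriv \<Omega> [i] u) (weak_deriv \<Omega> [i] u) \<le> L2_inner \<Omega> (grad \<Omega> u) (grad \<Omega> u)"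
    unfolding L2_inner_grad[OF u u] by (rule member_le_sum) (auto simp: L2_inner_self_nonneg)
  then show "sqrt (L2_inner \<Omega> u u) \<le> H1_norm \<Omega> u"
    and "sqrt (L2_inner \<Omega> (weak_deriv \<Omega> [i] u) (weak_deriv \<Omega> [i] u)) \<le> H1_norm \<Omega> u"
    using L2_inner_self_nonneg[of \<Omega> u] L2_inner_self_nonneg[of \<Omega> "grad \<Omega> u"]
    by (auto simp: H1_norm_def)
qed

lemma test_functions_sobolev:
  "open \<Omega> \<Longrightarrow> \<phi> \<in> test_functions \<Omega> \<Longrightarrow> \<phi> \<in> sobolev 1 \<Omega>"
  by (intro sobolev_1I[of _ _ "\<lambda>i. partial_deriv i \<phi>"] test_functions_L2 has_weak_deriv_test_function)

text \<open>The constant sequence approximates \<open>\<phi>\<close>.  Its error has \<open>H\<^sup>1\<close> norm zero only because weak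
  derivatives are unique: the gradient of the zero function is a chosen representative, of
  which only the class modulo null sets is known.\<close>

lemma test_functions_H10:
  assumes \<Omega>: "open \<Omega>" and \<phi>: "\<phi> \<in> test_functions \<Omega>"
  shows "\<phi> \<in> H10 \<Omega>"
proof -
  let ?z = "\<lambda>x. \<phi> x - \<phi> x"
  have dz: "has_weak_deriv \<Omega> [i] ?z (\<lambda>x. partial_deriv i \<phi> x - partial_deriv i \<phi> x)" for i
    by (intro has_weak_deriv_diff has_weak_deriv_test_function \<Omega> \<phi>)
  have z: "?z \<in> sobolev 1 \<Omega>"
    by (rule sobolev_1I[OF _ dz]) (simp add: L2_def)
  have "L2_inner \<Omega> (weak_deriv \<Omega> [i] ?z) (weak_deriv \<Omega> [i] ?z) = 0" for i
  proof -
    have d: "has_weak_deriv \<Omega> [i] ?z (weak_deriv \<Omega> [i] ?z)"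
      by (rule has_weak_deriv_weak_deriv[OF z]) simp
    have "L2_inner \<Omega> (weak_deriv \<Omega> [i] ?z) (weak_deriv \<Omega> [i] ?z)
        = L2_inner \<Omega> (\<lambda>x. partial_deriv i \<phi> x - partial_deriv i \<phi> x) (weak_deriv \<Omega> [i] ?z)"
      by (intro L2_inner_cong_left has_weak_deriv_unique[OF \<Omega> d dz] has_weak_deriv_L2(2)[OF d]
        has_weak_deriv_L2(2)[OF dz])
    then show ?thesis by (simp add: L2_inner_def)
  qed
  then have "H1_norm \<Omega> ?z = 0"
    using L2_inner_grad[OF z z] by (simp add: H1_norm_def L2_inner_def[of _ "\<lambda>_. 0 :: real"])
  then have "(\<lambda>k::nat. H1_norm \<Omega> ?z) \<longlonglongrightarrow> 0" by simp
  then show ?thesis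
    using test_functions_sobolev[OF \<Omega> \<phi>] \<phi> unfolding H10_def
    by (intro CollectI conjI exI[of _ "\<lambda>_. \<phi>"]) auto
qed

section \<open>Green's formula\<close>

lemma laplacian_L2:
  assumes "v \<in> sobolev 2 \<Omega>"
  shows "laplacian \<Omega> v \<in> L2 \<Omega>"
  unfolding laplacian_def[abs_def] by (intro L2_sum weak_deriv_L2[OF assms]) auto

text \<open>Both \<open>(v, \<partial>\<^sub>i \<partial>\<^sub>i \<phi>) = - (\<partial>\<^sub>i v, \<partial>\<^sub>i \<phi>)\<close>, where \<open>\<partial>\<^sub>i \<phi>\<close> is the test function, and
  \<open>(v, \<partial>\<^sub>i \<partial>\<^sub>i \<phi>) = (\<partial>\<^sub>i \<partial>\<^sub>i v, \<phi>)\<close> are instances of the definition of weak derivatives.\<close>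

lemma green_test_function:
  assumes \<Omega>: "open \<Omega>" and \<phi>: "\<phi> \<in> test_functions \<Omega>" and v: "v \<in> sobolev 2 \<Omega>"
  shows "(\<Sum>i\<in>UNIV. L2_inner \<Omega> (partial_deriv i \<phi>) (weak_deriv \<Omega> [i] v))
    = - L2_inner \<Omega> \<phi> (laplacian \<Omega> v)"
proof -
  have "L2_inner \<Omega> (partial_deriv i \<phi>) (weak_deriv \<Omega> [i] v)
      = - L2_inner \<Omega> (weak_deriv \<Omega> [i, i] v) \<phi>" for i
  proof -
    have "L2_inner \<Omega> v (iter_partial [i] (partial_deriv i \<phi>))
        = - L2_inner \<Omega> (weak_deriv \<Omega> [i] v) (partial_deriv i \<phi>)"
      using has_weak_deriv_tested[OF has_weak_deriv_weak_deriv[OF v, of "[i]"]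
          test_functions_partial_deriv[OF \<phi>, of i]] by simp
    moreover have "L2_inner \<Omega> v (iter_partial [i, i] \<phi>) = L2_inner \<Omega> (weak_deriv \<Omega> [i, i] v) \<phi>"
      using has_weak_deriv_tested[OF has_weak_deriv_weak_deriv[OF v, of "[i, i]"] \<phi>] by simp
    ultimately show ?thesis
      by (simp add: iter_partial_def L2_inner_commute)
  qed
  moreover have "L2_inner \<Omega> (laplacian \<Omega> v) \<phi> = (\<Sum>i\<in>UNIV. L2_inner \<Omega> (weak_deriv \<Omega> [i, i] v) \<phi>)"
    unfolding laplacian_def[abs_def]
    by (rule L2_inner_sum_left) (auto intro: weak_deriv_L2[OF v] test_functions_L2[OF \<Omega> \<phi>])
  ultimately show ?thesis
    by (simp add: sum_negf L2_inner_commute[of \<Omega> \<phi>])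
qed

text \<open>For fixed \<open>v \<in> H\<^sup>2\<close> the defect \<open>B s = (\<nabla>s, \<nabla>v) + (s, \<triangle>v)\<close> is linear in \<open>s\<close>, bounded in
  the \<open>H\<^sup>1\<close> norm, and zero on test functions, which are dense in \<open>H\<^sub>0\<^sup>1\<close>.  There is no boundary
  term because \<open>s\<close> has zero trace.\<close>

lemma green_H10:
  assumes \<Omega>: "open \<Omega>" and s: "s \<in> H10 \<Omega>" and v: "v \<in> sobolev 2 \<Omega>"
  shows "L2_inner \<Omega> (grad \<Omega> s) (grad \<Omega> v) = - L2_inner \<Omega> s (laplacian \<Omega> v)"
proof -
  have s1: "s \<in> sobolev 1 \<Omega>" using s by (simp add: H10_def)
  have v1: "v \<in> sobolev 1 \<Omega>" using sobolev_mono[of 1 2 \<Omega>] v by auto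
  obtain \<phi> where \<phi>: "\<And>k::nat. \<phi> k \<in> test_functions \<Omega>"
    and lim: "(\<lambda>k. H1_norm \<Omega> (\<lambda>x. s x - \<phi> k x)) \<longlonglongrightarrow> 0"
    using s by (auto simp: H10_def)
  define B where "B = (\<lambda>u. (\<Sum>i\<in>UNIV. L2_inner \<Omega> (weak_deriv \<Omega> [i] u) (weak_deriv \<Omega> [i] v))
    + L2_inner \<Omega> u (laplacian \<Omega> v))"
  define C where "C = (\<Sum>i\<in>UNIV. sqrt (L2_inner \<Omega> (weak_deriv \<Omega> [i] v) (weak_deriv \<Omega> [i] v)))
    + sqrt (L2_inner \<Omega> (laplacian \<Omega> v) (laplacian \<Omega> v))"
  have dv: "weak_deriv \<Omega> [i] v \<in> L2 \<Omega>" for i by (rule weak_deriv_L2[OF v1]) simp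
  have lv: "laplacian \<Omega> v \<in> L2 \<Omega>" by (rule laplacian_L2[OF v])
  have bound: "\<bar>B u\<bar> \<le> H1_norm \<Omega> u * C" if u: "u \<in> sobolev 1 \<Omega>" for u
  proof -
    have du: "weak_deriv \<Omega> [i] u \<in> L2 \<Omega>" for i by (rule weak_deriv_L2[OF u]) simp
    have "\<bar>L2_inner \<Omega> (weak_deriv \<Omega> [i] u) (weak_deriv \<Omega> [i] v)\<bar>
        \<le> H1_norm \<Omega> u * sqrt (L2_inner \<Omega> (weak_deriv \<Omega> [i] v) (weak_deriv \<Omega> [i] v))" for i
      by (rule order_trans[OF L2_Cauchy_Schwarz[OF du dv]])
        (intro mult_right_mono H1_norm_bounds[OF u] real_sqrt_ge_zero L2_inner_self_nonneg)
    moreover have "\<bar>L2_inner \<Omega> u (laplacian \<Omega> v)\<bar>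
        \<le> H1_norm \<Omega> u * sqrt (L2_inner \<Omega> (laplacian \<Omega> v) (laplacian \<Omega> v))"
      by (rule order_trans[OF L2_Cauchy_Schwarz[OF sobolev_L2[OF u] lv]])
        (intro mult_right_mono H1_norm_bounds[OF u] real_sqrt_ge_zero L2_inner_self_nonneg)
    ultimately show ?thesis
      unfolding B_def C_def distrib_left sum_distrib_left
      by (intro order_trans[OF abs_triangle_ineq] add_mono order_trans[OF sum_abs] sum_mono)
  qed
  have "B s = B (\<lambda>x. s x - \<phi> k x) \<and> (\<lambda>x. s x - \<phi> k x) \<in> sobolev 1 \<Omega>" for k
  proof
    let ?r = "\<lambda>x. s x - \<phi> k x"
    have ds: "has_weak_deriv \<Omega> [i] s (weak_deriv \<Omega> [i] s)" for i
      by (rule has_weak_deriv_weak_deriv[OF s1]) simp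
    have d\<phi>: "has_weak_deriv \<Omega> [i] (\<phi> k) (partial_deriv i (\<phi> k))" for i
      by (rule has_weak_deriv_test_function[OF \<Omega> \<phi>])
    note dr = has_weak_deriv_diff[OF \<Omega> ds d\<phi>]
    show r: "?r \<in> sobolev 1 \<Omega>"
      by (rule sobolev_1I[OF _ dr]) (rule has_weak_deriv_L2(1)[OF dr])
    have dr': "has_weak_deriv \<Omega> [i] ?r (weak_deriv \<Omega> [i] ?r)" for i
      by (rule has_weak_deriv_weak_deriv[OF r]) simp
    have "L2_inner \<Omega> (weak_deriv \<Omega> [i] ?r) (weak_deriv \<Omega> [i] v)
        = L2_inner \<Omega> (weak_deriv \<Omega> [i] s) (weak_deriv \<Omega> [i] v)
          - L2_inner \<Omega> (partial_deriv i (\<phi> k)) (weak_deriv \<Omega> [i] v)" for i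
      using L2_inner_cong_left[OF has_weak_deriv_unique[OF \<Omega> dr' dr] has_weak_deriv_L2(2)[OF dr']
          has_weak_deriv_L2(2)[OF dr] dv]
      by (simp add: L2_inner_diff_left[OF has_weak_deriv_L2(2)[OF ds] has_weak_deriv_L2(2)[OF d\<phi>] dv])
    moreover have "L2_inner \<Omega> ?r (laplacian \<Omega> v)
        = L2_inner \<Omega> s (laplacian \<Omega> v) - L2_inner \<Omega> (\<phi> k) (laplacian \<Omega> v)"
      by (rule L2_inner_diff_left[OF sobolev_L2[OF s1] test_functions_L2[OF \<Omega> \<phi>] lv])
    ultimately show "B s = B ?r"
      using green_test_function[OF \<Omega> \<phi> v, of k] by (simp add: B_def sum_subtractf)
  qed
  then have "\<bar>B s\<bar> \<le> H1_norm \<Omega> (\<lambda>x. s x - \<phi> k x) * C" for k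
    using bound by metis
  moreover have "(\<lambda>k. H1_norm \<Omega> (\<lambda>x. s x - \<phi> k x) * C) \<longlonglongrightarrow> 0 * C"
    by (intro tendsto_mult_right lim)
  ultimately have "\<bar>B s\<bar> \<le> 0 * C"
    by (intro LIMSEQ_le_const) auto
  then show ?thesis
    by (simp add: B_def L2_inner_grad[OF s1 v1])
qed

section \<open>The mixed and the primal problem\<close>

text \<open>Test functions in the weak equation, with Green's formula on the left, identify \<open>\<triangle>u\<close> as \<open>- \<psi>\<close>
  by the fundamental lemma.\<close>

lemma laplacian_of_weak_solution:
  assumes \<Omega>: "open \<Omega>" and u: "u \<in> sobolev 2 \<Omega>" and \<psi>: "\<psi> \<in> L2 \<Omega>"
    and weak: "\<And>v. v \<in> H10 \<Omega> \<Longrightarrow> L2_inner \<Omega> (grad \<Omega> u) (grad \<Omega> v) = L2_inner \<Omega> \<psi> v"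
  shows "ae_equal \<Omega> (laplacian \<Omega> u) (\<lambda>x. - \<psi> x)"
proof (rule L2_equal_if_tested_equal[OF \<Omega> laplacian_L2[OF u]])
  show "(\<lambda>x. - \<psi> x) \<in> L2 \<Omega>" using L2_cmult[OF \<psi>, of "-1"] by simp
  fix \<phi> assume \<phi>: "\<phi> \<in> test_functions \<Omega>"
  note H = test_functions_H10[OF \<Omega> \<phi>]
  have "L2_inner \<Omega> \<psi> \<phi> = - L2_inner \<Omega> \<phi> (laplacian \<Omega> u)"
    using weak[OF H] green_H10[OF \<Omega> H u] by (simp add: L2_inner_commute)
  then show "L2_inner \<Omega> (laplacian \<Omega> u) \<phi> = L2_inner \<Omega> (\<lambda>x. - \<psi> x) \<phi>"
    by (simp add: L2_inner_uminus_left L2_inner_commute)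
qed

text \<open>Since \<open>\<triangle>u = - \<psi>\<close> and \<open>\<psi> \<in> H\<^sub>0\<^sup>1\<close>, Green's formula gives
  \<open>(\<triangle>u, \<triangle>v) = - (\<psi>, \<triangle>v) = (\<nabla>\<psi>, \<nabla>v)\<close>, so the primal equation for \<open>v\<close> is the first mixed
  equation with \<open>(\<psi>, v)\<close> replaced by \<open>(\<nabla>u, \<nabla>v)\<close> through the second.\<close>

lemma mixed_solution_solves_primal:
  assumes \<Omega>: "open \<Omega>" and mixed: "mixed_solution \<Omega> \<epsilon> f \<psi> u" and u2: "u \<in> sobolev 2 \<Omega>"
  shows "primal_solution \<Omega> \<epsilon> f u"
  unfolding primal_solution_def
proof (intro conjI ballI)
  from mixed have \<psi>: "\<psi> \<in> H10 \<Omega>" and u: "u \<in> H10 \<Omega>"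
    and eq1: "\<And>v. v \<in> H10 \<Omega> \<Longrightarrow>
      \<epsilon>\<^sup>2 * L2_inner \<Omega> (grad \<Omega> \<psi>) (grad \<Omega> v) + L2_inner \<Omega> \<psi> v = L2_inner \<Omega> f v"
    and eq2: "\<And>v. v \<in> H10 \<Omega> \<Longrightarrow> L2_inner \<Omega> (grad \<Omega> u) (grad \<Omega> v) = L2_inner \<Omega> \<psi> v"
    by (auto simp: mixed_solution_def)
  show "u \<in> sobolev 2 \<Omega> \<inter> H10 \<Omega>" using u u2 by blast
  fix v assume "v \<in> sobolev 2 \<Omega> \<inter> H10 \<Omega>"
  then have v2: "v \<in> sobolev 2 \<Omega>" and v: "v \<in> H10 \<Omega>" by auto
  have \<psi>L: "\<psi> \<in> L2 \<Omega>" using \<psi> by (auto simp: H10_def intro: sobolev_L2)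
  have m\<psi>L: "(\<lambda>x. - \<psi> x) \<in> L2 \<Omega>" using L2_cmult[OF \<psi>L, of "-1"] by simp
  have "L2_inner \<Omega> (laplacian \<Omega> u) (laplacian \<Omega> v) = L2_inner \<Omega> (\<lambda>x. - \<psi> x) (laplacian \<Omega> v)"
    by (rule L2_inner_cong_left[OF laplacian_of_weak_solution[OF \<Omega> u2 \<psi>L eq2]
          laplacian_L2[OF u2] m\<psi>L laplacian_L2[OF v2]])
  also have "\<dots> = L2_inner \<Omega> (grad \<Omega> \<psi>) (grad \<Omega> v)"
    by (simp add: L2_inner_uminus_left green_H10[OF \<Omega> \<psi> v2])
  finally show "\<epsilon>\<^sup>2 * L2_inner \<Omega> (laplacian \<Omega> u) (laplacian \<Omega> v) + L2_inner \<Omega> (grad \<Omega> u) (grad \<Omega> v)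
      = L2_inner \<Omega> f v"
    using eq1[OF v] eq2[OF v] by simp
qed

theorem theorem2p1:
  fixes \<Omega> :: "(real^'n::finite) set"
    and \<epsilon> :: real
    and f utilde \<psi> u :: "real^'n \<Rightarrow> real"
  assumes dim: "CARD('n) \<in> {2, 3}"
    and dom: "polyhedral_lipschitz_domain \<Omega>"
    and f: "f \<in> L2 \<Omega>"
    and eps: "\<epsilon> > 0"
    and primal: "primal_solution \<Omega> \<epsilon> f utilde"
    and primal_unique: "\<And>w. primal_solution \<Omega> \<epsilon> f w \<Longrightarrow> ae_equal \<Omega> w utilde"
    and mixed: "mixed_solution \<Omega> \<epsilon> f \<psi> u"
    and mixed_unique:
      "\<And>\<rho> w. mixed_solution \<Omega> \<epsilon> f \<rho> w \<Longrightarrow> ae_equal \<Omega> \<rho> \<psi> \<and> ae_equal \<Omega> w u"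
  shows "ae_equal \<Omega> utilde u \<longleftrightarrow> u \<in> sobolev 2 \<Omega>"
proof
  have \<Omega>: "open \<Omega>" using dom by (simp add: polyhedral_lipschitz_domain_def)
  {
    assume "ae_equal \<Omega> utilde u"
    then show "u \<in> sobolev 2 \<Omega>"
    proof (rule sobolev_ae_equal[OF \<Omega>])
      show "utilde \<in> sobolev 2 \<Omega>" using primal by (simp add: primal_solution_def)
      show "u \<in> L2 \<Omega>" using mixed by (auto simp: mixed_solution_def H10_def intro: sobolev_L2)
    qed
  next
    assume "u \<in> sobolev 2 \<Omega>"
    then have "ae_equal \<Omega> u utilde"
      by (intro primal_unique mixed_solution_solves_primal[OF \<Omega> mixed])
    then show "ae_equal \<Omega> utilde u"
      by (simp add: ae_equal_def eq_commute)
  }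
qed

end
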